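(* Let $\Omega\subset\mathbb{C}_\infty$ be a hyperbolic simply connected domain. Suppose that there is a totally disconnected subset $S\subset\partial_{\mathbb{C}_\infty}\Omega\cap\mathbb{C}$ such that $\partial_{\mathbb{C}_\infty}\Omega$ is locally connected at every point of $(\partial_{\mathbb{C}_\infty}\Omega\cap\mathbb{C})\setminus S$. Then $\partial_{\mathbb{C}_\infty}\Omega$ is locally connected everywhere.
   Context: $\mathbb{C}_\infty=\mathbb{C}\cup\{\infty\}$ is the Riemann sphere and $\partial_{\mathbb{C}_\infty}\Omega$ is the boundary of $\Omega$ in $\mathbb{C}_\infty$. A simply connected domain $\Omega\subset\mathbb{C}_\infty$ is hyperbolic if its Kobayashi pseudodistance is a distance, equivalently if it is biholomorphic to the unit disc. *)

theory Defs
  imports "HOL-Analysis.Analysis"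
begin

section \<open>The Riemann sphere\<close>

datatype riemann_sphere = Fin complex | Infty

text \<open>The topology of the one-point compactification of the plane.\<close>

instantiation riemann_sphere :: topological_space
begin

definition open_riemann_sphere :: "riemann_sphere set \<Rightarrow> bool" where
  "open_riemann_sphere U \<longleftrightarrow>
     open (Fin -` U) \<and> (Infty \<in> U \<longrightarrow> compact (- (Fin -` U)))"

instance
proof
  show "open (UNIV :: riemann_sphere set)"
    by (simp add: open_riemann_sphere_def)
next
  fix S T :: "riemann_sphere set"
  assume "open S" "open T"
  then show "open (S \<inter> T)"
    by (auto simp: open_riemann_sphere_def vimage_Int Compl_Int intro: compact_Un)
next
  fix K :: "riemann_sphere set set"
  assume K: "\<forall>S\<in>K. open S"
  have op: "open (Fin -` \<Union>K)"
    using K by (auto simp: open_riemann_sphere_def vimage_Union)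
  moreover have "compact (- (Fin -` \<Union>K))" if inf: "Infty \<in> \<Union>K"
  proof -
    obtain S where S: "S \<in> K" "Infty \<in> S"
      using inf by blast
    then have "compact (- (Fin -` S))"
      using K by (auto simp: open_riemann_sphere_def)
    moreover have "- (Fin -` \<Union>K) = - (Fin -` S) \<inter> - (Fin -` \<Union>K)"
      using S by auto
    ultimately show ?thesis
      using op by (metis closed_Compl compact_Int_closed)
  qed
  ultimately show "open (\<Union>K)"
    by (simp add: open_riemann_sphere_def)
qed

end

text \<open>The coordinates \<open>w\<close> and \<open>1/w\<close>; the values at \<open>Infty\<close> and \<open>Fin 0\<close> respectively lie
  outside the chart domains and are irrelevant.\<close>

primrec coord :: "riemann_sphere \<Rightarrow> complex" where
  "coord (Fin w) = w"
| "coord Infty = 0"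

primrec coord_inf :: "riemann_sphere \<Rightarrow> complex" where
  "coord_inf (Fin w) = inverse w"
| "coord_inf Infty = 0"

definition sphere_holomorphic_on :: "(complex \<Rightarrow> riemann_sphere) \<Rightarrow> complex set \<Rightarrow> bool" where
  "sphere_holomorphic_on f U \<longleftrightarrow>
     continuous_on U f \<and>
     (\<lambda>z. coord (f z)) holomorphic_on {z \<in> U. f z \<noteq> Infty} \<and>
     (\<lambda>z. coord_inf (f z)) holomorphic_on {z \<in> U. f z \<noteq> Fin 0}"

section \<open>Kobayashi hyperbolicity\<close>

definition poincare_dist :: "complex \<Rightarrow> complex \<Rightarrow> real" where
  "poincare_dist a b = artanh (cmod ((a - b) / (1 - cnj a * b)))"

text \<open>Lengths of chains of holomorphic discs in \<open>\<Omega>\<close> joining \<open>p = x 0\<close> to \<open>q = x n\<close>; the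
  \<open>i\<close>-th disc \<open>f i\<close> joins \<open>x i\<close> to \<open>x (Suc i)\<close>.\<close>

definition kobayashi_chain_lengths ::
    "riemann_sphere set \<Rightarrow> riemann_sphere \<Rightarrow> riemann_sphere \<Rightarrow> real set" where
  "kobayashi_chain_lengths \<Omega> p q =
     {(\<Sum>i<n. poincare_dist (a i) (b i)) | (n :: nat) f a b x.
        x 0 = p \<and> x n = q \<and>
        (\<forall>i<n. sphere_holomorphic_on (f i) (ball 0 1) \<and> f i ` ball 0 1 \<subseteq> \<Omega> \<and>
               a i \<in> ball 0 1 \<and> b i \<in> ball 0 1 \<and>
               f i (a i) = x i \<and> f i (b i) = x (Suc i))}"

text \<open>For a domain \<open>\<Omega>\<close> and points of \<open>\<Omega>\<close> the infimum is over a nonempty set of nonnegative reals.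
  The value \<open>0\<close> off \<open>\<Omega>\<close> is a dummy: \<^const>\<open>Metric_space\<close> demands nonnegativity and symmetry on
  the whole type.\<close>

definition kobayashi :: "riemann_sphere set \<Rightarrow> riemann_sphere \<Rightarrow> riemann_sphere \<Rightarrow> real" where
  "kobayashi \<Omega> p q =
     (if p \<in> \<Omega> \<and> q \<in> \<Omega> then Inf (kobayashi_chain_lengths \<Omega> p q) else 0)"

definition kobayashi_hyperbolic :: "riemann_sphere set \<Rightarrow> bool" where
  "kobayashi_hyperbolic \<Omega> \<longleftrightarrow> Metric_space \<Omega> (kobayashi \<Omega>)"

section \<open>Totally disconnected sets\<close>

definition totally_disconnected :: "'a::topological_space set \<Rightarrow> bool" where
  "totally_disconnected S \<longleftrightarrow> (\<forall>C. C \<subseteq> S \<and> connected C \<longrightarrow> (\<exists>x. C \<subseteq> {x}))"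

end

(* Let K be the boundary of \<Omega> in the sphere. Moving a point outside \<Omega> to infinity, the
   characterisation of planar simply connected domains by their boundaries shows that K is
   connected, hence a continuum. If a compact connected Hausdorff space is not weakly locally
   connected at a point x, then arbitrarily close to x there is a nondegenerate connected set
   through x at none of whose points it is weakly locally connected. In K all such bad points lie
   in S together with infinity. A bad point in the plane yields a nondegenerate connected subset
   of S; if infinity is bad, then so is some point in the plane. Hence K is weakly locally
   connected everywhere, which is equivalent to local connectedness. *)

theory Submission
  imports Defs "HOL-Complex_Analysis.Riemann_Mapping"
begin

section \<open>Points where a continuum is not locally connected\<close>

text \<open>In a compact Hausdorff space quasi-components are components (the cut wire theorem).
  Applied to \<open>P\<close>: if no connected set joins \<open>x\<close> to \<open>Q\<close>, some
  clopen splitting of \<open>P\<close> separates them.\<close>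

lemma closedin_connectedin_separation:
  assumes "compact_space X" "Hausdorff_space X" "closedin X P" "x \<in> P" "closedin X Q" "Q \<subseteq> P"
    and "\<And>T. \<lbrakk>connectedin X T; T \<subseteq> P; x \<in> T\<rbrakk> \<Longrightarrow> T \<inter> Q = {}"
  obtains A B where "closedin X A" "closedin X B" "openin (subtopology X P) A"
    "A \<union> B = P" "A \<inter> B = {}" "x \<in> A" "Q \<subseteq> B"
proof -
  let ?Y = "subtopology X P"
  have PX: "P \<subseteq> topspace X"
    using assms(3) closedin_subset by blast
  have "separated_between ?Y {x} Q"
  proof (rule cut_wire_fence_theorem)
    show "compact_space ?Y"
      by (simp add: assms(1,3) closedin_compact_space compact_space_subtopology)
    show "Hausdorff_space ?Y"
      by (simp add: assms(2) Hausdorff_space_subtopology)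
    then show "closedin ?Y {x}"
      using assms(4) PX
      by (intro closedin_t1_singleton Hausdorff_imp_t1_space) auto
    show "closedin ?Y Q"
      by (rule closedin_subset_topspace[OF assms(5,6)])
    show "disjnt C {x} \<or> disjnt C Q" if "connectedin ?Y C" for C
    proof -
      have "x \<in> C \<Longrightarrow> C \<inter> Q = {}"
        using that by (intro assms(7)) (simp_all add: connectedin_subtopology)
      then show ?thesis by (auto simp: disjnt_def)
    qed
  qed
  then obtain A B where AB: "closedin ?Y A" "closedin ?Y B" "A \<union> B = topspace ?Y" "disjnt A B"
      "{x} \<subseteq> A" "Q \<subseteq> B"
    unfolding separated_between_alt by blast
  have "topspace ?Y - B = A"
    using AB(3,4) by (auto simp: disjnt_def)
  then have "openin ?Y A"
    using openin_diff[OF openin_topspace AB(2)] by simp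
  then show thesis
    using AB that[of A B] assms(3) PX by (auto simp: disjnt_def closedin_closed_subtopology)
qed

text \<open>By contradiction, with the separation lemma used twice: first to choose a neighbourhood
  \<open>W\<close> of \<open>x\<close>, then to split its closure with \<open>I\<close> removed.
  Boundary bumping yields a connected set that violates the second splitting.\<close>

lemma continuum_of_local_disconnectedness:
  assumes X: "compact_space X" "Hausdorff_space X" "connected_space X"
    and x: "x \<in> topspace X" "\<not> weakly_locally_connected_at x X"
    and O: "openin X U" "x \<in> U"
  obtains T where "connectedin X T" "x \<in> T" "T \<subseteq> U" "T \<noteq> {x}"
    "\<And>z. z \<in> T \<Longrightarrow> \<not> weakly_locally_connected_at z X"
proof (rule ccontr)
  assume "\<not> thesis"
  with that have no: "T = {x}" if "connectedin X T" "x \<in> T" "T \<subseteq> U"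
      "\<forall>z\<in>T. \<not> weakly_locally_connected_at z X" for T
    using that by blast
  have normal: "normal_space X"
    using X compact_Hausdorff_or_regular_imp_normal_space by blast
  obtain W0 where W0: "openin X W0" "x \<in> W0"
    and bad: "\<And>H M. \<lbrakk>openin X H; connectedin X M; x \<in> H; H \<subseteq> M\<rbrakk> \<Longrightarrow> \<not> M \<subseteq> W0"
  proof -
    obtain W0 where "openin X W0" "x \<in> W0"
      and "\<nexists>H M. openin X H \<and> connectedin X M \<and> x \<in> H \<and> H \<subseteq> M \<and> M \<subseteq> W0"
      using x(2) unfolding weakly_locally_connected_at_def neighbourhood_base_at_def by auto
    then show thesis
      by (intro that[of W0]) auto
  qed
  \<comment> \<open>\<open>W0\<close> contains no connected neighbourhood of \<open>x\<close>, and
    \<open>U\<close> confines the set \<open>T\<close> that is sought.\<close>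
  define G where "G = W0 \<inter> U"
  have G: "openin X G" "x \<in> G"
    using W0 O by (auto simp: G_def)
  have GX: "G \<subseteq> topspace X"
    using G openin_subset by blast
  define C where "C = connected_component_of_set (subtopology X G) x"
  have C: "connectedin X C" "x \<in> C" "C \<subseteq> G"
    using G GX connectedin_connected_component_of[of "subtopology X G" x]
    by (auto simp: C_def connectedin_subtopology connected_component_of_refl)
  have Cmax: "M \<subseteq> C" if M: "connectedin X M" "M \<subseteq> G" "M \<inter> C \<noteq> {}" for M
  proof -
    obtain m where m: "m \<in> M" "m \<in> C" using M(3) by blast
    have "connectedin (subtopology X G) M"
      using M(1,2) by (simp add: connectedin_subtopology)
    then have "M \<subseteq> connected_component_of_set (subtopology X G) m"
      using m by (simp add: connected_component_of_maximal)
    also have "\<dots> = C"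
      using m(2) unfolding C_def by (metis connected_component_of_equiv mem_Collect_eq)
    finally show ?thesis .
  qed
  define I where "I = X interior_of C"
  have I: "openin X I" "I \<subseteq> C"
    by (auto simp: I_def interior_of_subset)
  \<comment> \<open>Otherwise \<open>C\<close> would be a connected neighbourhood of
    \<open>x\<close> inside \<open>W0\<close>.\<close>
  have xI: "x \<notin> I"
    using bad[OF I(1) C(1) _ I(2)] C(3) by (auto simp: G_def)
  (* Every point where the component C of x in G fails to be a neighbourhood is bad; P below
     collects those near x. The component of x in P leaves V: otherwise P could be split off inside an
     open W whose boundary meets C only in its interior I. Components of the closure of W through
     points of W - C near x reach that boundary outside C, and hence, by compactness, so does a
     connected set through x, contradicting the maximality of C. *)
  have CI_bad: "\<not> weakly_locally_connected_at z X" if z: "z \<in> C - I" for z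
  proof
    assume "weakly_locally_connected_at z X"
    then obtain H M where "openin X H" "connectedin X M" "z \<in> H" "H \<subseteq> M" "M \<subseteq> G"
      using z C(3) G(1) unfolding weakly_locally_connected_at_def neighbourhood_base_at_def
      by (meson DiffD1 subsetD)
    \<comment> \<open>\<open>M\<close> is connected in \<open>G\<close> and meets \<open>C\<close>
      at \<open>z\<close>, so the component absorbs it.\<close>
    moreover from this have "M \<subseteq> C"
      using Cmax[of M] z by blast
    ultimately have "z \<in> I"
      unfolding I_def interior_of_def by blast
    then show False using z by blast
  qed
  \<comment> \<open>\<open>C\<close> is closed only relative to \<open>G\<close>. If the closure of
    \<open>V\<close> stays in \<open>G\<close>, then cutting \<open>C\<close> down to that closure
    gives a set closed in \<open>X\<close>.\<close>
  obtain V where V: "openin X V" "x \<in> V" "X closure_of V \<subseteq> G"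
  proof -
    have "closedin X {x}"
      using X(2) x(1) by (intro closedin_t1_singleton Hausdorff_imp_t1_space)
    then show thesis
      using normal[unfolded normal_space_alt] G that by (metis empty_subsetI insert_subset)
  qed
  have clV_C: "closedin X (C \<inter> X closure_of V)"
  proof -
    have "closedin (subtopology X G) C"
      by (simp add: C_def closedin_connected_component_of)
    then obtain D where D: "closedin X D" "C = D \<inter> G"
      by (auto simp: closedin_subtopology)
    have "C \<inter> X closure_of V = D \<inter> X closure_of V"
      using D(2) V(3) by blast
    then show ?thesis
      by (simp add: D(1) closedin_Int)
  qed
  have VclV: "V \<subseteq> X closure_of V"
    by (simp add: V(1) closure_of_subset openin_subset)
  define P where "P = (C \<inter> X closure_of V) - I"
  have P: "closedin X P" "x \<in> P"
    using clV_C I(1) C(2) V(2) VclV xI by (auto simp: P_def closedin_diff)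
  obtain A B where AB: "closedin X A" "closedin X B" "A \<union> B = P" "A \<inter> B = {}" "x \<in> A" "P - V \<subseteq> B"
  proof (rule closedin_connectedin_separation[OF X(1,2) P])
    show "closedin X (P - V)" using P V by (simp add: closedin_diff)
    show "P - V \<subseteq> P" by blast
    fix T assume T: "connectedin X T" "T \<subseteq> P" "x \<in> T"
    \<comment> \<open>\<open>T\<close> consists of bad points in \<open>U\<close>, so the
      contradiction hypothesis \<open>no\<close> applies.\<close>
    then have "T = {x}"
      using no[of T] CI_bad C(3) by (auto simp: P_def G_def)
    then show "T \<inter> (P - V) = {}" using V(2) by blast
  qed
  obtain W1 W2 where W12: "openin X W1" "openin X W2" "A \<subseteq> W1" "B \<subseteq> W2" "W1 \<inter> W2 = {}"
    using normal AB unfolding normal_space_def disjnt_def by meson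
  \<comment> \<open>As \<open>P - V\<close> lies in \<open>B\<close>, the set \<open>A\<close> lies
    in \<open>V\<close> and hence in \<open>W\<close>; \<open>W2\<close> keeps the closure of
    \<open>W\<close> away from \<open>B\<close>. So \<open>P\<close> meets that closure only inside
    \<open>W\<close>.\<close>
  define W where "W = W1 \<inter> V"
  have W: "openin X W" "x \<in> W"
    using W12 V AB by (auto simp: W_def)
  let ?K = "X closure_of W"
  have WK: "W \<subseteq> ?K"
    by (simp add: W(1) closure_of_subset openin_subset)
  have KV: "?K \<subseteq> X closure_of V"
    by (simp add: W_def closure_of_mono)
  have KB: "?K \<inter> B = {}"
  proof -
    have "?K \<inter> W2 = {}"
      using W12 by (auto simp: W_def openin_Int_closure_of_eq_empty Int_commute)
    then show ?thesis using W12 by blast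
  qed
  have KP: "P \<inter> (?K - W) = {}"
    using KB AB W12(3) by (auto simp: W_def)
  have KG: "?K \<subseteq> G"
    using KV V(3) by blast
  \<comment> \<open>A point of \<open>C\<close> in \<open>?K - W\<close> but outside
    \<open>I\<close> would belong to \<open>P\<close>, against \<open>KP\<close>. Removing
    \<open>I\<close> therefore makes the boundary part \<open>Q\<close> disjoint from
    \<open>C\<close>.\<close>
  define Z where "Z = ?K - I"
  define Q where "Q = Z - W"
  have Z: "closedin X Z" "x \<in> Z"
    using I(1) W WK xI by (auto simp: Z_def closedin_diff)
  have Q: "closedin X Q" "Q \<subseteq> Z"
    using Z W by (auto simp: Q_def closedin_diff)
  have QC: "Q \<inter> C = {}"
    using KP KV by (auto simp: Q_def Z_def P_def)
  \<comment> \<open>A connected subset of \<open>Z\<close> through \<open>x\<close> lies in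
    \<open>G\<close>, hence in \<open>C\<close>, and so misses \<open>Q\<close>.\<close>
  obtain A' B' where AB': "openin (subtopology X Z) A'" "A' \<union> B' = Z" "A' \<inter> B' = {}" 
      "x \<in> A'" "Q \<subseteq> B'" "closedin X A'" "closedin X B'"
  proof (rule closedin_connectedin_separation[OF X(1,2) Z Q])
    fix T assume T: "connectedin X T" "T \<subseteq> Z" "x \<in> T"
    then have "T \<subseteq> C"
      using Cmax[of T] C(2) KG by (auto simp: Z_def)
    then show "T \<inter> Q = {}" using QC by blast
  qed
  obtain H where H: "openin X H" "A' = H \<inter> Z"
    using AB'(1) by (auto simp: openin_subtopology)
  \<comment> \<open>An open set about \<open>x\<close> inside \<open>C\<close> would put
    \<open>x\<close> into \<open>I\<close>. The resulting point \<open>y\<close> generates a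
    component of \<open>?K\<close> that avoids \<open>C\<close>.\<close>
  have "\<not> H \<inter> W \<subseteq> C"
  proof
    assume "H \<inter> W \<subseteq> C"
    then have "H \<inter> W \<subseteq> I"
      unfolding I_def by (simp add: H(1) W(1) interior_of_maximal openin_Int)
    then show False using xI W(2) AB'(4) H(2) by blast
  qed
  then obtain y where y: "y \<in> H" "y \<in> W" "y \<notin> C" by blast
  define D where "D = connected_component_of_set (subtopology X ?K) y"
  have yK: "y \<in> topspace (subtopology X ?K)"
    using y WK W(1) openin_subset by fastforce
  have D: "connectedin X D" "D \<subseteq> ?K" "y \<in> D"
    using yK connectedin_connected_component_of[of "subtopology X ?K" y]
    by (auto simp: D_def connectedin_subtopology connected_component_of_refl)
  \<comment> \<open>Boundary bumping requires a proper subset. If \<open>?K\<close> were everything,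
    the connected space itself would be a neighbourhood of \<open>x\<close> inside
    \<open>W0\<close>.\<close>
  have "?K \<noteq> topspace X"
  proof
    assume "?K = topspace X"
    then have "topspace X \<subseteq> W0" using KG by (auto simp: G_def)
    then show False
      using bad[of "topspace X" "topspace X"] X(3) x(1) by (auto simp: connectedin_topspace)
  qed
  have "D \<inter> X frontier_of ?K \<noteq> {}"
  proof (rule boundary_bumping_theorem_closed[OF X(3,1,2) _ \<open>?K \<noteq> topspace X\<close>])
    show "D \<in> connected_components_of (subtopology X ?K)"
      using yK by (auto simp: D_def connected_components_of_def)
  qed auto
  moreover have "X frontier_of ?K \<subseteq> ?K - W"
    using interior_of_maximal[OF WK W(1)] by (auto simp: frontier_of_def)
  moreover have "D \<inter> C = {}"
    using Cmax[of D] D KG y(3) by blast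
  then have DZ: "D \<subseteq> Z"
    using D(2) I(2) by (auto simp: Z_def)
  ultimately have DQ: "D \<inter> B' \<noteq> {}"
    using AB'(5) by (auto simp: Q_def)
  moreover have "y \<in> A'"
    using y D(3) DZ H by blast
  ultimately show False
    using D(1,3) DZ AB' unfolding connectedin_closedin by blast
qed

section \<open>The topology of the Riemann sphere\<close>

lemma inj_Fin: "inj_on Fin A"
  by (simp add: inj_on_def)

lemma Fin_vimage_image [simp]: "Fin -` Fin ` A = A"
  by (simp add: inj_Fin inj_vimage_image_eq)

lemma notin_range_Fin [simp]: "x \<notin> range Fin \<longleftrightarrow> x = Infty"
  by (cases x) auto

lemma open_Fin_vimage: "open U \<Longrightarrow> open (Fin -` U)"
  by (simp add: open_riemann_sphere_def)

lemma open_Fin_image: "open A \<Longrightarrow> open (Fin ` A)"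
  by (auto simp: open_riemann_sphere_def)

lemma open_Compl_Fin_image: "compact A \<Longrightarrow> open (- Fin ` A)"
  by (auto simp: open_riemann_sphere_def vimage_Compl compact_imp_closed)

lemma continuous_on_Fin [continuous_intros]: "continuous_on A Fin"
  by (rule continuous_on_subset[OF _ subset_UNIV])
     (simp add: continuous_on_open_vimage open_Fin_vimage)

lemma continuous_on_coord: "continuous_on (range Fin) coord"
proof -
  have "coord -` B \<inter> range Fin = Fin ` B" for B
    by auto
  then show ?thesis
    by (simp add: continuous_on_open_vimage open_Fin_image)
qed

instance riemann_sphere :: t2_space
proof
  fix x y :: riemann_sphere
  have sep_Infty: "\<exists>U V. open U \<and> open V \<and> Infty \<in> U \<and> Fin z \<in> V \<and> U \<inter> V = {}" for z
    by (rule exI[of _ "- Fin ` cball z 1"], rule exI[of _ "Fin ` ball z 1"])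
       (auto simp: open_Compl_Fin_image open_Fin_image)
  have sep_Fin: "\<exists>U V. open U \<and> open V \<and> Fin w \<in> U \<and> Fin z \<in> V \<and> U \<inter> V = {}" if wz: "w \<noteq> z" for w z
  proof -
    obtain U V where UV: "open U" "open V" "w \<in> U" "z \<in> V" "U \<inter> V = {}"
      using hausdorff[OF wz] by blast
    then show ?thesis
      by (intro exI[of _ "Fin ` U"] exI[of _ "Fin ` V"]) (auto simp: open_Fin_image)
  qed
  assume "x \<noteq> y"
  then show "\<exists>U V. open U \<and> open V \<and> x \<in> U \<and> y \<in> V \<and> U \<inter> V = {}"
    using sep_Infty sep_Fin by (cases x; cases y) (simp_all, metis inf_commute)
qed

text \<open>The Moebius map \<open>1/z\<close>. The point \<open>Fin 0\<close> is treated separately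
  because \<open>inverse 0 = 0\<close> would send it to \<open>Fin 0\<close>.\<close>

definition inversion :: "riemann_sphere \<Rightarrow> riemann_sphere" where
  "inversion x = (if x = Fin 0 then Infty else Fin (coord_inf x))"

lemma inversion_simps [simp]:
  "inversion Infty = Fin 0" "inversion (Fin 0) = Infty"
  "z \<noteq> 0 \<Longrightarrow> inversion (Fin z) = Fin (inverse z)"
  by (auto simp: inversion_def)

lemma inversion_inversion [simp]: "inversion (inversion x) = x"
proof (cases x)
  case (Fin z)
  then show ?thesis by (cases "z = 0") auto
qed auto

text \<open>Inversion exchanges neighbourhoods of 0 and infinity: the exterior of a disc of radius
  \<open>R\<close> corresponds to a punctured disc of radius \<open>1/R\<close> about 0.\<close>

lemma open_inversion_vimage:
  assumes U: "open U"
  shows "open (inversion -` U)"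
proof -
  let ?A = "Fin -` U"
  have A: "open ?A" using U by (rule open_Fin_vimage)
  have eq: "Fin -` inversion -` U = {z. z \<noteq> 0 \<and> inverse z \<in> ?A} \<union> (if Infty \<in> U then {0} else {})"
  proof (rule set_eqI)
    fix z show "z \<in> Fin -` inversion -` U \<longleftrightarrow> z \<in> {z. z \<noteq> 0 \<and> inverse z \<in> ?A} \<union> (if Infty \<in> U then {0} else {})"
      by (cases "z = 0") auto
  qed
  have "open (- {0::complex} \<inter> inverse -` ?A)"
    using A by (intro continuous_open_preimage) (auto intro!: continuous_intros)
  then have op: "open {z::complex. z \<noteq> 0 \<and> inverse z \<in> ?A}"
    by (simp add: Collect_conj_eq Compl_eq vimage_def)
  have "open (Fin -` inversion -` U)"
  proof (cases "Infty \<in> U")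
    case True
    then have "bounded (- ?A)"
      using U by (simp add: open_riemann_sphere_def compact_imp_bounded)
    then obtain R where R: "R > 0" "\<And>z. z \<in> - ?A \<Longrightarrow> norm z \<le> R"
      unfolding bounded_pos by blast
    have "ball 0 (inverse R) \<subseteq> Fin -` inversion -` U"
    proof
      fix z :: complex assume z: "z \<in> ball 0 (inverse R)"
      show "z \<in> Fin -` inversion -` U"
      proof (cases "z = 0")
        case False
        then have "R < norm (inverse z)"
          using z R(1) by (simp add: norm_inverse) (metis inverse_inverse_eq less_imp_inverse_less zero_less_norm_iff)
        then have "inverse z \<in> ?A"
          using R(2)[of "inverse z"] by force
        then show ?thesis using False by simp
      qed (use True in auto)
    qed
    then have "Fin -` inversion -` U = {z. z \<noteq> 0 \<and> inverse z \<in> ?A} \<union> ball 0 (inverse R)"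
      unfolding eq using True R(1) by auto
    then show ?thesis using open_Un[OF op open_ball] by simp
  next
    case False
    then show ?thesis using eq op by simp
  qed
  moreover have "compact (- (Fin -` inversion -` U))" if "Infty \<in> inversion -` U"
  proof -
    have "0 \<in> ?A" using that by simp
    then obtain r where r: "r > 0" "ball 0 r \<subseteq> ?A"
      using A open_contains_ball by blast
    have "norm z \<le> inverse r" if z: "z \<notin> Fin -` inversion -` U" for z
    proof (cases "z = 0")
      case False
      then have "inverse z \<notin> ball 0 r" using r z by auto
      then have "r \<le> inverse (norm z)" by (simp add: norm_inverse)
      then show ?thesis
        using le_imp_inverse_le[OF _ r(1)] by fastforce
    qed (use r in auto)
    then have "bounded (- (Fin -` inversion -` U))"
      unfolding bounded_iff by blast
    then show ?thesis
      using \<open>open (Fin -` inversion -` U)\<close> by (simp only: compact_eq_bounded_closed closed_Compl)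
  qed
  ultimately show ?thesis
    by (simp add: open_riemann_sphere_def)
qed

lemma continuous_on_inversion: "continuous_on A inversion"
  by (rule continuous_on_subset[OF _ subset_UNIV])
     (simp add: continuous_on_open_vimage open_inversion_vimage)

definition translation :: "complex \<Rightarrow> riemann_sphere \<Rightarrow> riemann_sphere" where
  "translation a x = (case x of Fin z \<Rightarrow> Fin (a + z) | Infty \<Rightarrow> Infty)"

lemma translation_simps [simp]:
  "translation a Infty = Infty" "translation a (Fin z) = Fin (a + z)"
  by (auto simp: translation_def)

lemma translation_translation [simp]: "translation a (translation b x) = translation (a + b) x"
  by (cases x) (auto simp: add.assoc)

lemma translation_0 [simp]: "translation 0 x = x"
  by (cases x) auto

lemma continuous_on_translation: "continuous_on A (translation a)"
proof -
  have "open (translation a -` U)" if U: "open U" for U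
  proof -
    have eq: "Fin -` translation a -` U = (+) (- a) ` Fin -` U"
      by (force simp: image_iff)
    have "open (Fin -` translation a -` U)"
      unfolding eq by (intro open_translation open_Fin_vimage U)
    moreover have "compact (- (Fin -` translation a -` U))" if "Infty \<in> U"
    proof -
      have "compact ((+) (- a) ` (- (Fin -` U)))"
        by (rule compact_translation) (use U that in \<open>simp add: open_riemann_sphere_def\<close>)
      then show ?thesis
        unfolding eq by (simp only: bij_image_Compl_eq[OF bij_plus])
    qed
    ultimately show ?thesis
      by (simp add: open_riemann_sphere_def)
  qed
  then have "continuous_on UNIV (translation a)"
    by (simp add: continuous_on_open_vimage)
  then show ?thesis
    by (rule continuous_on_subset) simp
qed

text \<open>The closed unit disc and its image under \<open>inversion\<close> cover the
  sphere.\<close>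

lemma compact_UNIV_riemann_sphere: "compact (UNIV :: riemann_sphere set)"
proof -
  have "x \<in> Fin ` cball 0 1 \<union> inversion ` Fin ` cball 0 1" for x
  proof (cases x)
    case Infty
    then show ?thesis by (intro UnI2 image_eqI[of _ _ "Fin 0"]) auto
  next
    case (Fin z)
    show ?thesis
    proof (cases "norm z \<le> 1")
      case False
      then have "norm (inverse z) \<le> 1" "z \<noteq> 0"
        by (auto simp: norm_inverse inverse_le_1_iff)
      then show ?thesis
        using Fin by (intro UnI2 image_eqI[of _ _ "Fin (inverse z)"]) auto
    qed (use Fin in auto)
  qed
  then have "(UNIV :: riemann_sphere set) = Fin ` cball 0 1 \<union> inversion ` Fin ` cball 0 1"
    by blast
  moreover have "compact \<dots>"
    by (intro compact_Un compact_continuous_image continuous_on_Fin continuous_on_inversion compact_cball)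
  ultimately show ?thesis by simp
qed

lemma exists_homeomorphism_to_Infty:
  fixes p :: riemann_sphere
  obtains h k :: "riemann_sphere \<Rightarrow> riemann_sphere" where "homeomorphism UNIV UNIV h k" "h p = Infty"
proof (cases p)
  case Infty
  have "homeomorphism UNIV UNIV (\<lambda>x::riemann_sphere. x) (\<lambda>x. x)"
    by (simp add: homeomorphism_def)
  then show ?thesis using Infty that by blast
next
  case (Fin a)
  \<comment> \<open>Translate \<open>a\<close> to 0, then invert.\<close>
  have "homeomorphism UNIV UNIV (inversion \<circ> translation (- a)) (translation a \<circ> inversion)"
    by (rule homeomorphismI)
       (simp_all add: continuous_on_compose continuous_on_inversion continuous_on_translation del: o_apply,
        simp_all)
  then show ?thesis using Fin that by force
qed

text \<open>\<open>Fin\<close> is continuous and open: a plane open set missing the preimage of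
  \<open>A\<close> has an open image missing \<open>A\<close>.\<close>

lemma Fin_vimage_closure: "Fin -` closure A = closure (Fin -` A)"
proof
  have "closed (Fin -` closure A)"
    using open_Fin_vimage[of "- closure A"] by (simp add: vimage_Compl open_closed)
  then show "closure (Fin -` A) \<subseteq> Fin -` closure A"
    by (intro closure_minimal) (use closure_subset in auto)
  show "Fin -` closure A \<subseteq> closure (Fin -` A)"
  proof
    fix z assume z: "z \<in> Fin -` closure A"
    show "z \<in> closure (Fin -` A)"
    proof (rule ccontr)
      assume "z \<notin> closure (Fin -` A)"
      moreover have "open (Fin ` (- closure (Fin -` A)))"
        by (intro open_Fin_image open_Compl closed_closure)
      moreover have "A \<inter> Fin ` (- closure (Fin -` A)) = {}"
        using closure_subset[of "Fin -` A"] by auto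
      ultimately show False
        using z open_Int_closure_eq_empty[of "Fin ` (- closure (Fin -` A))" A] by blast
    qed
  qed
qed

text \<open>A bounded set has compact closure, whose image is closed and omits infinity. Conversely,
  an open set containing infinity has compact complement in the plane.\<close>

lemma Infty_in_closure_Fin_image: "Infty \<in> closure (Fin ` A) \<longleftrightarrow> \<not> bounded A"
proof
  assume "Infty \<in> closure (Fin ` A)"
  moreover have "closure (Fin ` A) \<subseteq> Fin ` closure A" if "bounded A"
    by (intro closure_minimal compact_imp_closed compact_continuous_image continuous_on_Fin)
       (use that closure_subset in auto)
  ultimately show "\<not> bounded A" by auto
next
  assume A: "\<not> bounded A"
  show "Infty \<in> closure (Fin ` A)"
  proof (rule ccontr)
    assume "Infty \<notin> closure (Fin ` A)"
    then have "compact (- (Fin -` (- closure (Fin ` A))))"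
      using open_Compl[OF closed_closure[of "Fin ` A"]] unfolding open_riemann_sphere_def by blast
    then have "compact (closure A)"
      by (simp add: vimage_Compl Fin_vimage_closure)
    then show False
      using A bounded_subset[OF compact_imp_bounded closure_subset] by blast
  qed
qed

section \<open>Boundaries of simply connected domains\<close>

text \<open>For bounded \<open>W\<close> the plane frontier is connected. For unbounded
  \<open>W\<close> each of its components is unbounded, so infinity lies in the closure of each and
  joins them all.\<close>

lemma connected_frontier_Fin_image:
  assumes W: "open W" "simply_connected W"
  shows "connected (frontier (Fin ` W))"
proof -
  have frontier: "Fin z \<in> frontier (Fin ` W) \<longleftrightarrow> z \<in> frontier W" for z
  proof -
    have "Fin z \<in> closure (Fin ` W) \<longleftrightarrow> z \<in> closure W"
      using Fin_vimage_closure[of "Fin ` W"] by auto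
    then show ?thesis
      using W(1) by (auto simp: frontier_def interior_open open_Fin_image)
  qed
  show ?thesis
  proof (cases "bounded W")
    case True
    then have "Infty \<notin> frontier (Fin ` W)"
      by (simp add: frontier_def Infty_in_closure_Fin_image)
    then have "x \<in> frontier (Fin ` W) \<longleftrightarrow> x \<in> Fin ` frontier W" for x
      using frontier by (cases x) auto
    then have "frontier (Fin ` W) = Fin ` frontier W"
      by blast
    moreover have "connected (frontier W)"
      using simply_connected_eq_frontier_properties[OF W(1)] W(2) True by simp
    ultimately show ?thesis
      by (simp add: connected_continuous_image continuous_on_Fin)
  next
    case False
    let ?\<C> = "components (frontier W)"
    have unb: "\<not> bounded C" if "C \<in> ?\<C>" for C
      using simply_connected_eq_frontier_properties[OF W(1)] W(2) False that by simp
    have "Infty \<in> frontier (Fin ` W)"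
      using False W(1) by (auto simp: frontier_def Infty_in_closure_Fin_image interior_open open_Fin_image)
    then have "x \<in> frontier (Fin ` W) \<longleftrightarrow> x \<in> insert Infty (Fin ` frontier W)" for x
      using frontier by (cases x) auto
    then have "frontier (Fin ` W) = insert Infty (Fin ` \<Union>?\<C>)"
      by (simp only: Union_components) blast
    \<comment> \<open>The extra member \<open>{Infty}\<close> covers the case of an empty plane
      frontier, where there are no components.\<close>
    also have "\<dots> = \<Union>(insert {Infty} ((\<lambda>C. insert Infty (Fin ` C)) ` ?\<C>))"
      by blast
    also have "connected \<dots>"
    proof (rule connected_Union)
      have "connected (insert Infty (Fin ` C))" if C: "C \<in> ?\<C>" for C
      proof (rule connected_intermediate_closure)
        show "connected (Fin ` C)"
          by (rule connected_continuous_image[OF continuous_on_Fin in_components_connected[OF C]])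
        show "insert Infty (Fin ` C) \<subseteq> closure (Fin ` C)"
          by (simp add: closure_subset Infty_in_closure_Fin_image unb[OF C])
      qed (rule subset_insertI)
      then show "connected D" if "D \<in> insert {Infty} ((\<lambda>C. insert Infty (Fin ` C)) ` ?\<C>)" for D
        using that by (metis (no_types, lifting) connected_sing imageE insertE)
      show "\<Inter>(insert {Infty} ((\<lambda>C. insert Infty (Fin ` C)) ` ?\<C>)) \<noteq> {}"
        by (intro ex_in_conv[THEN iffD1] exI[of _ Infty]) simp
    qed
    finally show ?thesis .
  qed
qed

lemma connected_frontier_simply_connected:
  fixes \<Omega> :: "riemann_sphere set"
  assumes \<Omega>: "open \<Omega>" "simply_connected \<Omega>"
  shows "connected (frontier \<Omega>)"
proof (cases "\<Omega> = UNIV")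
  case True
  then show ?thesis by simp
next
  case False
  then obtain p where p: "p \<notin> \<Omega>" by blast
  obtain h k where hk: "homeomorphism UNIV UNIV h k" "h p = Infty"
    by (rule exists_homeomorphism_to_Infty)
  have kh: "k (h x) = x" and hk': "h (k x) = x" for x
    using hk(1) by (auto simp: homeomorphism_def)
  have ch: "continuous_on A h" and ck: "continuous_on A k" for A
    using hk(1) continuous_on_subset by (auto simp: homeomorphism_def intro: continuous_on_subset)
  \<comment> \<open>The retraction lemma serves to transport simple connectedness along a
    homeomorphism, here \<open>h\<close> with inverse \<open>k\<close>, and below
    \<open>coord\<close> with inverse \<open>Fin\<close>.\<close>
  have "simply_connected (h ` \<Omega>)"
    by (rule simply_connected_retraction_gen[OF \<Omega>(2) ch refl ck]) (auto simp: kh hk')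
  moreover have "Infty \<notin> h ` \<Omega>"
    using p kh hk(2) by (metis imageE)
  then have sub: "h ` \<Omega> \<subseteq> range Fin"
    using notin_range_Fin by (metis subsetI)
  then have eq: "h ` \<Omega> = Fin ` coord ` h ` \<Omega>"
    by force
  ultimately have "simply_connected (coord ` h ` \<Omega>)"
    by (intro simply_connected_retraction_gen[where h = coord and k = Fin and S = "h ` \<Omega>"])
       (auto intro: continuous_on_subset[OF continuous_on_coord sub] continuous_on_Fin)
  moreover have "h ` \<Omega> = k -` \<Omega>"
    by (auto simp: kh) (metis hk' imageI)
  then have "open (h ` \<Omega>)"
    using \<Omega>(1) ck[of UNIV] by (simp add: continuous_on_open_vimage)
  then have "open (coord ` h ` \<Omega>)"
    using open_Fin_vimage[of "h ` \<Omega>"] eq by (metis Fin_vimage_image)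
  ultimately have "connected (frontier (h ` \<Omega>))"
    using connected_frontier_Fin_image eq by metis
  moreover have "frontier (h ` \<Omega>) = h ` frontier \<Omega>"
  proof -
    have "homeomorphic_map euclidean euclidean h"
      unfolding homeomorphic_map_maps homeomorphic_maps_def
      using ch[of UNIV] ck[of UNIV] kh hk' by auto
    then show ?thesis
      using homeomorphic_map_frontier_of[of euclidean euclidean h \<Omega>] by simp
  qed
  ultimately have "connected (k ` h ` frontier \<Omega>)"
    by (metis connected_continuous_image ck)
  then show ?thesis
    by (simp add: image_image kh)
qed

section \<open>Local connectedness of the boundary\<close>

lemma Hausdorff_space_t2: "Hausdorff_space (euclidean :: 'a::t2_space topology)"
  unfolding Hausdorff_space_def disjnt_def by (metis hausdorff open_openin)

lemma locally_connected_at_imp_weakly: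
  "locally_connected_at x X \<Longrightarrow> weakly_locally_connected_at x X"
  unfolding locally_connected_at_def weakly_locally_connected_at_def
  by (erule neighbourhood_base_at_mono) simp

theorem lemma4p5:
  fixes \<Omega> S :: "riemann_sphere set"
  assumes "\<Omega> \<noteq> {}" and "open \<Omega>" and "connected \<Omega>" and "simply_connected \<Omega>" and "kobayashi_hyperbolic \<Omega>"
    and "S \<subseteq> frontier \<Omega> \<inter> range Fin" and "totally_disconnected S"
    and "\<And>x. x \<in> (frontier \<Omega> \<inter> range Fin) - S \<Longrightarrow>
           locally_connected_at x (top_of_set (frontier \<Omega>))"
  shows "\<forall>x \<in> frontier \<Omega>. locally_connected_at x (top_of_set (frontier \<Omega>))"
proof -
  let ?X = "top_of_set (frontier \<Omega>)"
  have "compact (frontier \<Omega>)"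
    by (metis compact_Int_closed compact_UNIV_riemann_sphere frontier_closed inf_top_left)
  then have X: "compact_space ?X" "Hausdorff_space ?X" "connected_space ?X"
    using connected_frontier_simply_connected[OF assms(2,4)] connectedin_iff_connected[of "frontier \<Omega>"]
    by (simp_all add: compact_space_subtopology Hausdorff_space_subtopology Hausdorff_space_t2 connectedin_def)
  have bad_in_S: "x \<in> S" if "\<not> weakly_locally_connected_at x ?X" "x \<in> frontier \<Omega>" "x \<noteq> Infty" for x
    using that assms(8)[of x] locally_connected_at_imp_weakly[of x ?X] notin_range_Fin[of x] by blast
  have fin: "weakly_locally_connected_at x ?X" if x: "x \<in> frontier \<Omega>" "x \<noteq> Infty" for x
  proof (rule ccontr)
    assume "\<not> weakly_locally_connected_at x ?X"
    \<comment> \<open>Deleting infinity leaves an open set about \<open>x\<close>, so the connected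
      set of bad points found in it stays in the plane and hence in \<open>S\<close>.\<close>
    moreover have "openin ?X (frontier \<Omega> - {Infty})"
      using openin_open_Int[OF open_Compl[OF closed_singleton], of "frontier \<Omega>" Infty]
      by (simp add: Diff_eq)
    ultimately obtain T where T: "connectedin ?X T" "x \<in> T" "T \<subseteq> frontier \<Omega> - {Infty}" "T \<noteq> {x}"
        "\<And>z. z \<in> T \<Longrightarrow> \<not> weakly_locally_connected_at z ?X"
      using continuum_of_local_disconnectedness[OF X, of x "frontier \<Omega> - {Infty}"] x by auto
    have "T \<subseteq> S"
      using T(3,5) bad_in_S by blast
    moreover have "connected T"
      using T(1) by (simp add: connectedin_subtopology)
    ultimately show False
      using assms(7) T(2,4) unfolding totally_disconnected_def by blast
  qed
  \<comment> \<open>Only infinity can still be bad, so a connected set of bad points through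
    \<open>x\<close> would be a singleton.\<close>
  have "weakly_locally_connected_at x ?X" if x: "x \<in> frontier \<Omega>" for x
  proof (rule ccontr)
    assume bad: "\<not> weakly_locally_connected_at x ?X"
    have "x \<in> topspace ?X"
      using x by simp
    then obtain T where T: "connectedin ?X T" "x \<in> T" "T \<noteq> {x}"
        "\<And>z. z \<in> T \<Longrightarrow> \<not> weakly_locally_connected_at z ?X"
      using continuum_of_local_disconnectedness[OF X _ bad openin_topspace] by metis
    have "T \<subseteq> frontier \<Omega>"
      using T(1) by (simp add: connectedin_subtopology)
    then have "T \<subseteq> {Infty}"
      using T(4) fin by blast
    then show False
      using T(2,3) by blast
  qed
  \<comment> \<open>At a single point the weak notion may be strictly weaker; required at every
    point, the two agree.\<close>
  then have "locally_connected_space ?X"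
    by (simp add: locally_connected_space_iff_weak)
  then show ?thesis
    by (simp add: locally_connected_space_alt neighbourhood_base_of_def locally_connected_at_def)
qed

end
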